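(* Let $p_{q^*}$ be the two-point marginal distribution defined in the context, and let $(S_1,Z_1),\dots,(S_{n_q},Z_{n_q})$ be i.i.d. with $S_i\sim p_{q^*}$ and, conditionally on $S_i=s$, $Z_i\in\{0,1\}$ distributed according to $p(z\mid s)$. Let $\overline{W}_{n_q}$ be the variant of the Friedman-Rafsky statistic computed from these samples, as defined in the context. Then, as $n_q\to\infty$, $$\mathrm{E}\left[\frac{\overline{W}_{n_q}}{n_q}\right]=\int 2\,p(Z=0\mid s)\,p(Z=1\mid s)\,p_{q^*}(s)\,ds+\mathcal{O}(n_q^{-1})-2uv .$$
   Context: Distribution $p_{q^*}$. Let $s_1,\dots,s_H\in\mathbb{R}^d$ be finitely many distinct points with given posterior label probabilities $p(Z=0\mid s_i)\in[0,1]$, $p(Z=1\mid s_i)=1-p(Z=0\mid s_i)$, not all $p(Z=0\mid s_i)$ equal. Let $u\in(0,1)$ be the prior probability of class $0$, with $\min_i p(Z=0\mid s_i)\le u\le\max_i p(Z=0\mid s_i)$, and let $v=1-u$. Let $q_0=\arg\min_i p(Z=0\mid s_i)$ and $q_1=\arg\max_i p(Z=0\mid s_i)$. Then $p_{q^*}$ is the discrete distribution with $$p_{q^*}(s_{q_0})=\frac{u-p(Z=0\mid s_{q_1})}{p(Z=0\mid s_{q_0})-p(Z=0\mid s_{q_1})},\qquad p_{q^*}(s_{q_1})=\frac{p(Z=0\mid s_{q_0})-u}{p(Z=0\mid s_{q_0})-p(Z=0\mid s_{q_1})},$$ and $p_{q^*}(s)=0$ for every other $s$. In particular $\sum_s p(Z=0\mid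 s)p_{q^*}(s)=u$. Since $p_{q^*}$ is discrete, the integral $\int g(s)p_{q^*}(s)\,ds$ means $g(s_{q_0})p_{q^*}(s_{q_0})+g(s_{q_1})p_{q^*}(s_{q_1})$. Statistic. Given labelled samples $(S_i,Z_i)_{i=1}^n$, construct a Euclidean minimum spanning tree on the $n$ vertices $1,\dots,n$ with edge weights $\|S_i-S_j\|$ (coincident sample points are distinct vertices at distance $0$; the tree is constructed from the features only, so that, if it is not unique, its choice does not depend on the labels). Let $R_n$ be the number of cut-edges, i.e. edges of the tree joining vertices with different labels. Let $\mathcal{X}$ and $\mathcal{Y}$ be the sets of samples with $Z_i=0$ and $Z_i=1$, with sizes $n_0=|\mathcal{X}|$ and $n_1=|\mathcal{Y}|$, $n=n_0+n_1$. The quantity $\mathrm{E}[R_n\mid H_0,|\mathcal{X}|,|\mathcal{Y}|]$ is the expectation of $R_n$ under the null hypothesis $H_0$ (labels independent of features) given the class sizes, and equals $\frac{2n_0n_1}{n}$. The variant of the Friedman-Rafsky statistic is $$\overline{W}_n=R_n-\mathrm{E}[R_n\mid H_0,|\mathcal{X}|,|\mathcal{Y}|]=R_n-\frac{2n_0n_1}{n}.$$ The $\mathcal{O}(n_q^{-1})$ term is for fixed $p_{q^*}$ and fixed posteriors as $n_q\to\infty$. *)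

theory Defs
  imports "HOL-Probability.Probability" "HOL-Library.Landau_Symbols"
begin

section \<open>The two-point marginal and the labelled samples\<close>

definition pqstar_mass :: "('a \<Rightarrow> real) \<Rightarrow> real \<Rightarrow> 'a \<Rightarrow> 'a \<Rightarrow> 'a \<Rightarrow> real" where
  "pqstar_mass \<eta> u a b x =
     (if x = a then (u - \<eta> b) / (\<eta> a - \<eta> b)
      else if x = b then (\<eta> a - u) / (\<eta> a - \<eta> b)
      else 0)"

text \<open>Here \<open>\<eta> x\<close> is the posterior probability of class 0 at \<open>x\<close>; \<open>a\<close> and \<open>b\<close> are
  the points minimising and maximising it. The lemma \<open>pmf_pqstar\<close> shows that
  \<^const>\<open>embed_pmf\<close> is applied to a genuine mass function in that situation.\<close>

definition pqstar :: "('a \<Rightarrow> real) \<Rightarrow> real \<Rightarrow> 'a \<Rightarrow> 'a \<Rightarrow> 'a pmf" where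
  "pqstar \<eta> u a b = embed_pmf (pqstar_mass \<eta> u a b)"

lemma pmf_pqstar:
  assumes "\<eta> a \<le> u" "u \<le> \<eta> b" "\<eta> a < \<eta> b"
  shows "pmf (pqstar \<eta> u a b) = pqstar_mass \<eta> u a b"
proof
  fix x
  have nn: "0 \<le> pqstar_mass \<eta> u a b y" for y
    using assms by (auto simp: pqstar_mass_def divide_nonpos_neg)
  have ab: "a \<noteq> b" using assms by auto
  have "(\<integral>\<^sup>+ y. ennreal (pqstar_mass \<eta> u a b y) \<partial>count_space UNIV)
      = (\<integral>\<^sup>+ y. ennreal (pqstar_mass \<eta> u a b y) \<partial>count_space {a, b})"
    by (rule nn_integral_count_space_eq) (auto simp: pqstar_mass_def)
  also have "\<dots> = ennreal (pqstar_mass \<eta> u a b a + pqstar_mass \<eta> u a b b)"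
    using ab nn by (simp add: nn_integral_count_space_finite ennreal_plus)
  also have "pqstar_mass \<eta> u a b a + pqstar_mass \<eta> u a b b = 1"
    using assms ab by (simp add: pqstar_mass_def add_divide_distrib[symmetric])
  finally show "pmf (pqstar \<eta> u a b) x = pqstar_mass \<eta> u a b x"
    unfolding pqstar_def using nn by (subst pmf_embed_pmf) auto
qed

text \<open>Joint law of \<open>(S, Z)\<close>: \<open>S\<close> has law \<open>\<mu>\<close> and, given \<open>S = x\<close>, the label \<open>Z\<close> is
  \<open>z\<close> with probability \<open>p z x\<close>, for \<open>z \<in> {0, 1}\<close>.\<close>

definition labelled_pmf :: "(nat \<Rightarrow> 'a \<Rightarrow> real) \<Rightarrow> 'a pmf \<Rightarrow> ('a \<times> nat) pmf" where
  "labelled_pmf p \<mu> =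
     bind_pmf \<mu> (\<lambda>x. map_pmf (\<lambda>c. (x, if c then 0 else 1)) (bernoulli_pmf (p 0 x)))"

lemma pmf_labelled_pmf:
  assumes "\<And>x. x \<in> set_pmf \<mu> \<Longrightarrow> 0 \<le> p 0 x \<and> p 0 x \<le> 1 \<and> p 1 x = 1 - p 0 x"
    and "z \<in> {0, 1}"
  shows "pmf (labelled_pmf p \<mu>) (x, z) = pmf \<mu> x * p z x"
proof -
  define c where "c = (z = 0)"
  have "pmf (map_pmf (\<lambda>c. (y, if c then 0 else 1)) (bernoulli_pmf (p 0 y))) (x, z)
      = p z x * indicator {x} y" if y: "y \<in> set_pmf \<mu>" for y
  proof (cases "y = x")
    case True
    have inj: "inj (\<lambda>c. (x, if c then 0 else 1 :: nat))"
      by (auto simp: inj_def split: if_splits)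
    have "(x, z) = (\<lambda>c. (x, if c then 0 else 1)) c"
      using assms(2) by (auto simp: c_def)
    then have "pmf (map_pmf (\<lambda>c. (x, if c then 0 else 1)) (bernoulli_pmf (p 0 x))) (x, z)
        = pmf (bernoulli_pmf (p 0 x)) c"
      by (simp only: pmf_map_inj'[OF inj])
    also have "\<dots> = p z x"
      using assms(1)[OF y] assms(2) True by (cases c) (auto simp: c_def)
    finally show ?thesis using True by simp
  next
    case False
    then show ?thesis by (auto simp: pmf_eq_0_set_pmf)
  qed
  then have "pmf (labelled_pmf p \<mu>) (x, z) = (\<integral>y. p z x * indicator {x} y \<partial>measure_pmf \<mu>)"
    unfolding labelled_pmf_def pmf_bind
    by (intro integral_cong_AE) (auto simp: AE_measure_pmf_iff)
  then show ?thesis by (simp add: pmf.rep_eq)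
qed

text \<open>The i.i.d. sample \<open>(S\<^sub>1, Z\<^sub>1), \<dots>, (S\<^sub>n, Z\<^sub>n)\<close>, as a function on \<open>{1..n}\<close> that takes a
  fixed dummy value elsewhere.\<close>

definition sample_pmf :: "(nat \<Rightarrow> 'a \<Rightarrow> real) \<Rightarrow> 'a pmf \<Rightarrow> nat \<Rightarrow> (nat \<Rightarrow> 'a \<times> nat) pmf" where
  "sample_pmf p \<mu> n = Pi_pmf {1..n} undefined (\<lambda>_. labelled_pmf p \<mu>)"


section \<open>Euclidean minimum spanning trees\<close>

text \<open>An undirected edge between \<open>i\<close> and \<open>j\<close> is represented exactly once, as the pair
  \<open>(min i j, max i j)\<close>; the symmetric closure \<open>E \<union> E\<inverse>\<close> is the adjacency relation.\<close>

definition cycle :: "(nat \<times> nat) set \<Rightarrow> nat list \<Rightarrow> bool" where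
  "cycle E c \<longleftrightarrow> 3 \<le> length c \<and> distinct c \<and>
     (\<forall>k<length c. (c ! k, c ! (Suc k mod length c)) \<in> E \<union> E\<inverse>)"

definition spanning_tree :: "nat set \<Rightarrow> (nat \<times> nat) set \<Rightarrow> bool" where
  "spanning_tree V E \<longleftrightarrow> E \<subseteq> {(i, j). i \<in> V \<and> j \<in> V \<and> i < j} \<and>
     (\<forall>i\<in>V. \<forall>j\<in>V. (i, j) \<in> (E \<union> E\<inverse>)\<^sup>*) \<and> (\<nexists>c. cycle E c)"

definition euclidean_weight :: "(nat \<Rightarrow> 'a::real_normed_vector) \<Rightarrow> (nat \<times> nat) set \<Rightarrow> real" where
  "euclidean_weight x E = (\<Sum>(i, j)\<in>E. norm (x i - x j))"

definition euclidean_mst :: "nat \<Rightarrow> (nat \<Rightarrow> 'a::real_normed_vector) \<Rightarrow> (nat \<times> nat) set \<Rightarrow> bool" where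
  "euclidean_mst n x E \<longleftrightarrow> spanning_tree {1..n} E \<and>
     (\<forall>F. spanning_tree {1..n} F \<longrightarrow> euclidean_weight x E \<le> euclidean_weight x F)"


section \<open>The variant of the Friedman-Rafsky statistic\<close>

definition cut_edges :: "(nat \<times> nat) set \<Rightarrow> (nat \<Rightarrow> nat) \<Rightarrow> nat" where
  "cut_edges E z = card {(i, j) \<in> E. z i \<noteq> z j}"

definition class_size :: "nat \<Rightarrow> (nat \<Rightarrow> nat) \<Rightarrow> nat \<Rightarrow> nat" where
  "class_size n z c = card {i \<in> {1..n}. z i = c}"

text \<open>The null expectation given the class sizes: each of the \<open>n - 1\<close> tree edges is cut with
  probability \<open>2 * n\<^sub>0 * n\<^sub>1 / (n * (n - 1))\<close>.\<close>

definition fr_null_mean :: "nat \<Rightarrow> (nat \<Rightarrow> nat) \<Rightarrow> real" where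
  "fr_null_mean n z = 2 * real (class_size n z 0) * real (class_size n z 1) / real n"

text \<open>The tree is chosen by a rule \<open>T\<close> that is applied to the sample size and the features
  only, so ties between minimum spanning trees are broken without looking at the labels.\<close>

definition fr_variant ::
  "(nat \<Rightarrow> (nat \<Rightarrow> 'a) \<Rightarrow> (nat \<times> nat) set) \<Rightarrow> nat \<Rightarrow> (nat \<Rightarrow> 'a \<times> nat) \<Rightarrow> real" where
  "fr_variant T n \<omega> =
     real (cut_edges (T n (fst \<circ> \<omega>)) (snd \<circ> \<omega>)) - fr_null_mean n (snd \<circ> \<omega>)"

end

theory Submission
  imports Defs
begin

text \<open>The sample takes only the two values \<open>a\<close> and \<open>b\<close>, so the weight of a spanning tree is
  \<open>norm (a - b)\<close> times the number of edges between the \<open>a\<close>-vertices and the \<open>b\<close>-vertices. A double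
  star has one such edge, hence a minimum spanning tree has at most one. Counting edges, it has
  \<open>N\<^sub>a + O(1)\<close> edges among the \<open>N\<^sub>a\<close> vertices at \<open>a\<close> and \<open>N\<^sub>b + O(1)\<close> edges among those at \<open>b\<close>.
  Given the features the labels are independent, so an edge inside \<open>x\<close> is cut with probability
  \<open>2 * p 0 x * p 1 x\<close>; taking expectations gives the cut-edge term up to \<open>O(1)\<close>. Unconditionally,
  \<open>n\<^sub>0 * n\<^sub>1\<close> has mean \<open>n * (n - 1) * u * v\<close>.\<close>

section \<open>Edge counts in acyclic and in connected graphs\<close>

text \<open>Take the first vertex of a longest path: a neighbour off the path would extend it, and a
  neighbour at index 2 or later would close a cycle, which leaves only index 1. An isolated vertex
  also qualifies, with an arbitrary \<open>y\<close>.\<close>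

lemma forest_leaf:
  assumes fin: "finite V" and ne: "V \<noteq> {}"
    and E: "E \<subseteq> {(i, j). i \<in> V \<and> j \<in> V \<and> i < j}" and acyc: "\<nexists>c. cycle E c"
  shows "\<exists>w\<in>V. \<exists>y. \<forall>v. (w, v) \<in> E \<union> E\<inverse> \<longrightarrow> v = y"
proof -
  define path where "path c \<longleftrightarrow> c \<noteq> [] \<and> distinct c \<and> set c \<subseteq> V \<and>
      (\<forall>k. Suc k < length c \<longrightarrow> (c ! k, c ! Suc k) \<in> E \<union> E\<inverse>)" for c
  obtain v0 where "v0 \<in> V" using ne by blast
  then have "path [v0]" by (simp add: path_def)
  moreover have bnd: "length c < Suc (card V)" if "path c" for c
    using that fin by (metis path_def distinct_card card_mono less_Suc_eq_le)
  ultimately obtain c where c: "path c" and mx: "\<And>c'. path c' \<Longrightarrow> length c' \<le> length c"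
    using ex_has_greatest_nat[of path "[v0]" length "Suc (card V)"] by (metis less_imp_le)
  have "v = c ! 1" if v: "(hd c, v) \<in> E \<union> E\<inverse>" for v
  proof -
    have vV: "v \<in> V" and vne: "v \<noteq> hd c" using v E by auto
    have "v \<in> set c"
    proof (rule ccontr)
      assume "v \<notin> set c"
      moreover have "((v # c) ! k, (v # c) ! Suc k) \<in> E \<union> E\<inverse>" if "Suc k < length (v # c)" for k
        using that v c by (cases k) (auto simp: path_def hd_conv_nth)
      ultimately have "path (v # c)" using c vV by (auto simp: path_def simp del: Un_iff)
      then show False using mx by fastforce
    qed
    then obtain k where k: "k < length c" "c ! k = v" by (auto simp: in_set_conv_nth)
    have "k \<noteq> 0" using k vne c by (metis hd_conv_nth path_def)
    moreover have "\<not> 2 \<le> k"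
    proof
      assume k2: "2 \<le> k"
      \<comment> \<open>The initial segment up to \<open>c ! k\<close>, closed by the edge from
        \<open>c ! k\<close> back to \<open>hd c\<close>; since \<open>k\<close> is at least 2 it
        has the three vertices that \<open>cycle\<close> demands.\<close>
      let ?c = "take (Suc k) c"
      have len: "length ?c = Suc k" using k by simp
      have "(?c ! l, ?c ! (Suc l mod length ?c)) \<in> E \<union> E\<inverse>" if l: "l < Suc k" for l
      proof (cases "l = k")
        case True
        then show ?thesis using v k c len by (auto simp: path_def hd_conv_nth)
      next
        case False
        then have "Suc l mod Suc k = Suc l" "l < k" using l by auto
        then show ?thesis using c k len by (auto simp: path_def)
      qed
      then have "cycle E ?c" using c k2 len unfolding cycle_def by (auto simp: path_def)
      then show False using acyc by blast
    qed
    ultimately have "k = 1" by linarith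
    then show ?thesis using k by simp
  qed
  moreover have "hd c \<in> V" using c by (auto simp: path_def)
  ultimately show ?thesis by blast
qed

lemma card_insert_le_Suc: "card (insert x A) \<le> Suc (card A)"
  by (cases "finite A") (auto simp: card_insert_if)

text \<open>Removing a vertex with at most one neighbour destroys at most one edge. The bound is one
  above the sharp value for nonempty \<open>V\<close>; this lets the induction start at the empty
  set and costs only a constant later.\<close>

lemma forest_card_le:
  assumes "finite V" "E \<subseteq> {(i, j). i \<in> V \<and> j \<in> V \<and> i < j}" "\<nexists>c. cycle E c"
  shows "card E \<le> card V"
  using assms
proof (induction V arbitrary: E rule: finite_psubset_induct)
  case (psubset V)
  show ?case
  proof (cases "V = {}")
    case True
    then show ?thesis using psubset.prems by auto
  next
    case False
    then obtain w y where w: "w \<in> V" and y: "\<And>v. (w, v) \<in> E \<union> E\<inverse> \<Longrightarrow> v = y"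
      using forest_leaf[OF psubset.hyps False psubset.prems] by metis
    define F where "F = {(i, j) \<in> E. i \<noteq> w \<and> j \<noteq> w}"
    have "cycle E c" if "cycle F c" for c
      using that unfolding cycle_def F_def by blast
    then have "card F \<le> card (V - {w})"
      using w psubset.prems by (intro psubset.IH) (auto simp: F_def)
    \<comment> \<open>Edges are stored as increasing pairs, so the only possible edge at
      \<open>w\<close> is this one. If \<open>w\<close> is isolated, the pair need not be in
      \<open>E\<close> and the inclusion still holds.\<close>
    moreover have "E \<subseteq> insert (min w y, max w y) F"
    proof
      fix e assume e: "e \<in> E"
      obtain i j where [simp]: "e = (i, j)" by fastforce
      have "i < j" using e psubset.prems by auto
      then show "e \<in> insert (min w y, max w y) F"
        using e y[of i] y[of j] by (auto simp: F_def)
    qed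
    moreover have "finite F"
      by (rule finite_subset[of _ "V \<times> V"]) (use psubset in \<open>auto simp: F_def\<close>)
    ultimately have "card E \<le> Suc (card (V - {w}))"
      using card_mono[of "insert (min w y, max w y) F" E]
        card_insert_le_Suc[of "(min w y, max w y)" F] by simp
    then show ?thesis using w psubset.hyps by (simp only: card_Suc_Diff1)
  qed
qed

text \<open>Grow a vertex set from a root, gaining at least one edge with each new vertex. A largest
  such set must be all of \<open>V\<close>, since by connectedness some edge leaves any smaller
  one.\<close>

lemma connected_card_le:
  assumes fin: "finite V" and E: "E \<subseteq> {(i, j). i \<in> V \<and> j \<in> V \<and> i < j}"
    and conn: "\<forall>i\<in>V. \<forall>j\<in>V. (i, j) \<in> (E \<union> E\<inverse>)\<^sup>*"
  shows "card V \<le> Suc (card E)"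
proof (cases "V = {}")
  case False
  then obtain r where r: "r \<in> V" by blast
  have finE: "finite E" by (rule finite_subset[of _ "V \<times> V"]) (use E fin in auto)
  define Q where "Q W \<longleftrightarrow> r \<in> W \<and> W \<subseteq> V \<and> card W \<le> Suc (card (E \<inter> W \<times> W))" for W
  have "Q {r}" using r by (simp add: Q_def)
  moreover have "card W < Suc (card V)" if "Q W" for W
    using that fin by (simp add: Q_def card_mono less_Suc_eq_le)
  ultimately obtain W where W: "Q W" and mx: "\<And>W'. Q W' \<Longrightarrow> card W' \<le> card W"
    using ex_has_greatest_nat[of Q "{r}" card "Suc (card V)"] by (metis less_imp_le)
  have finW: "finite W" using W fin finite_subset by (auto simp: Q_def)
  have "W = V"
  proof (rule ccontr)
    assume "W \<noteq> V"
    then obtain v where v: "v \<in> V" "v \<notin> W" using W by (auto simp: Q_def)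
    have "(r, v) \<in> (E \<union> E\<inverse>)\<^sup>*" using conn r v by blast
    \<comment> \<open>A walk from \<open>r\<close> inside \<open>W\<close> to a vertex outside has a
      step that leaves \<open>W\<close>; the implication is the invariant of the induction along the
      walk.\<close>
    then have "v \<notin> W \<longrightarrow> (\<exists>i\<in>W. \<exists>j. j \<notin> W \<and> (i, j) \<in> E \<union> E\<inverse>)"
      by (induction rule: rtrancl_induct) (use W in \<open>auto simp: Q_def\<close>)
    then obtain i j where ij: "i \<in> W" "j \<notin> W" "(i, j) \<in> E \<union> E\<inverse>" using v by blast
    let ?W = "insert j W"
    have "insert (if (i, j) \<in> E then (i, j) else (j, i)) (E \<inter> W \<times> W) \<subseteq> E \<inter> ?W \<times> ?W"
      using ij by auto
    then have "card (insert (if (i, j) \<in> E then (i, j) else (j, i)) (E \<inter> W \<times> W)) \<le> card (E \<inter> ?W \<times> ?W)"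
      using finE by (intro card_mono) auto
    then have "Suc (card (E \<inter> W \<times> W)) \<le> card (E \<inter> ?W \<times> ?W)"
      using finE ij by (subst (asm) card_insert_disjoint) auto
    moreover have "j \<in> V" using ij E by auto
    ultimately have "Q ?W" using W finW ij by (auto simp: Q_def)
    then show False using mx[of ?W] finW ij by simp
  qed
  then show ?thesis
    using W finE card_mono[of E "E \<inter> V \<times> V"] by (auto simp: Q_def intro: order_trans)
qed simp

section \<open>Minimum spanning trees of two-valued features\<close>

text \<open>Join every vertex to the hub of its class, \<open>i0\<close> or \<open>j0\<close>, and
  join the two hubs. This is the competitor against which a minimum spanning tree is
  compared.\<close>

lemma ex_double_star:
  assumes V: "finite V" "i0 \<in> V" "j0 \<in> V" "x i0 \<noteq> x j0" and x: "\<And>i. i \<in> V \<Longrightarrow> x i \<in> {x i0, x j0}"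
  obtains D where "spanning_tree V D" "card {(i, j) \<in> D. x i \<noteq> x j} \<le> 1"
proof -
  define h where "h i = (if x i = x i0 then i0 else j0)" for i
  define Q where "Q i j \<longleftrightarrow> j = h i \<or> (i = i0 \<and> j = j0)" for i j
  define D where "D = {(i, j). i \<in> V \<and> j \<in> V \<and> i < j \<and> (Q i j \<or> Q j i)}"
  have ne: "i0 \<noteq> j0" using V by auto
  have h0: "h i0 = i0" "h j0 = j0" using V by (auto simp: h_def)
  have hV: "h i \<in> {i0, j0}" for i by (simp add: h_def)
  have sym: "(i, j) \<in> D \<union> D\<inverse> \<longleftrightarrow> i \<in> V \<and> j \<in> V \<and> i \<noteq> j \<and> (Q i j \<or> Q j i)" for i j
    by (auto simp: D_def)
  have hub: "(i, i0) \<in> (D \<union> D\<inverse>)\<^sup>*" if i: "i \<in> V" for i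
  proof -
    have "(i, h i) \<in> (D \<union> D\<inverse>)\<^sup>*"
    proof (cases "i = h i")
      case False
      then have "(i, h i) \<in> D \<union> D\<inverse>" unfolding sym using i V hV[of i] by (auto simp: Q_def)
      then show ?thesis by blast
    qed simp
    moreover have "(j0, i0) \<in> D \<union> D\<inverse>" unfolding sym using V ne by (auto simp: Q_def)
    ultimately show ?thesis using hV[of i] by (metis insert_iff rtrancl.rtrancl_into_rtrancl singletonD)
  qed
  have "sym ((D \<union> D\<inverse>)\<^sup>*)" by (intro sym_rtrancl) (auto simp: sym_def)
  then have conn: "\<forall>i\<in>V. \<forall>j\<in>V. (i, j) \<in> (D \<union> D\<inverse>)\<^sup>*"
    using hub by (meson rtrancl_trans symD)
  have "\<not> cycle D c" for c
  proof
    assume c: "cycle D c"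
    define m where "m = length c"
    have m: "3 \<le> m" and d: "distinct c"
      and adj: "\<And>k. k < m \<Longrightarrow> (c ! k, c ! (Suc k mod m)) \<in> D \<union> D\<inverse>"
      using c by (auto simp: cycle_def m_def)
    have "c ! k \<in> {i0, j0}" if k: "k < m" for k
    proof (rule ccontr)
      \<comment> \<open>A vertex that is not a hub has a single neighbour, but the two neighbours on the cycle differ.\<close>
      assume nh: "c ! k \<notin> {i0, j0}"
      have leaf: "v = h (c ! k)" if "(c ! k, v) \<in> D \<union> D\<inverse>" for v
        using that nh hV[of v] unfolding sym Q_def by auto
      \<comment> \<open>The predecessor of \<open>k\<close> in cyclic order.\<close>
      define l where "l = (if k = 0 then m - 1 else k - 1)"
      have l: "l < m" "Suc l mod m = k" using k m by (auto simp: l_def)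
      have "(c ! k, c ! l) \<in> D \<union> D\<inverse>" using adj[OF l(1)] l(2) by auto
      then have "c ! l = c ! (Suc k mod m)" using leaf adj[OF k] by metis
      moreover have "Suc k mod m < m" using m by (intro mod_less_divisor) linarith
      ultimately have "l = Suc k mod m"
        using nth_eq_iff_index_eq[OF d, of l "Suc k mod m"] l by (simp add: m_def)
      \<comment> \<open>Predecessor and successor coincide only on cycles of length at most
        2.\<close>
      then show False using k m by (auto simp: l_def mod_Suc split: if_splits)
    qed
    then have "set c \<subseteq> {i0, j0}" by (metis in_set_conv_nth m_def subsetI)
    then have "card (set c) \<le> card {i0, j0}" by (intro card_mono) auto
    then show False using d m ne by (simp add: distinct_card m_def)
  qed
  then have "spanning_tree V D" using conn by (auto simp: spanning_tree_def D_def)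
  \<comment> \<open>A vertex and its hub carry the same value, so only the edge between the hubs can
    cross.\<close>
  moreover have "{(i, j) \<in> D. x i \<noteq> x j} \<subseteq> {(min i0 j0, max i0 j0)}"
  proof clarify
    fix i j assume ij: "(i, j) \<in> D" "x i \<noteq> x j"
    have "x (h v) = x v" if "v \<in> V" for v using x[OF that] by (auto simp: h_def)
    then have "{i, j} = {i0, j0}" "i < j" using ij unfolding D_def Q_def by auto
    then show "i = min i0 j0 \<and> j = max i0 j0" by (auto simp: doubleton_eq_iff min_def max_def)
  qed
  then have "card {(i, j) \<in> D. x i \<noteq> x j} \<le> 1"
    using card_mono[of "{(min i0 j0, max i0 j0)}" "{(i, j) \<in> D. x i \<noteq> x j}"] by simp
  ultimately show ?thesis by (rule that)
qed

lemma spanning_tree_finite: "spanning_tree V E \<Longrightarrow> finite V \<Longrightarrow> finite E"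
  unfolding spanning_tree_def by (rule finite_subset[of _ "V \<times> V"]) auto

lemma spanning_tree_edgeD:
  "spanning_tree V E \<Longrightarrow> (i, j) \<in> E \<Longrightarrow> i \<in> V \<and> j \<in> V \<and> i < j"
  by (auto simp: spanning_tree_def)

lemma euclidean_weight_two_valued:
  assumes "finite E" "\<And>i j. (i, j) \<in> E \<Longrightarrow> x i \<in> {a, b} \<and> x j \<in> {a, b}"
  shows "euclidean_weight x E = norm (a - b) * card {(i, j) \<in> E. x i \<noteq> x j}"
proof -
  have "euclidean_weight x E = (\<Sum>e\<in>{(i, j) \<in> E. x i \<noteq> x j}. norm (a - b))"
    unfolding euclidean_weight_def using assms
    by (intro sum.mono_neutral_cong_right) (fastforce simp: norm_minus_commute)+
  then show ?thesis by simp
qed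

lemma mst_two_valued_cross:
  assumes "euclidean_mst n x E" and x: "\<And>i. i \<in> {1..n} \<Longrightarrow> x i \<in> {a, b}" and "a \<noteq> b"
  shows "card {(i, j) \<in> E. x i \<noteq> x j} \<le> 1"
proof (cases "\<exists>i\<in>{1..n}. \<exists>j\<in>{1..n}. x i = a \<and> x j = b")
  case True
  then obtain i j where "i \<in> {1..n}" "j \<in> {1..n}" "x i = a" "x j = b" by blast
  with x \<open>a \<noteq> b\<close> obtain D where D: "spanning_tree {1..n} D" "card {(i, j) \<in> D. x i \<noteq> x j} \<le> 1"
    using ex_double_star[of "{1..n}" i j x] by auto
  have w: "euclidean_weight x F = norm (a - b) * card {(i, j) \<in> F. x i \<noteq> x j}"
    if "spanning_tree {1..n} F" for F
    using x spanning_tree_edgeD[OF that] spanning_tree_finite[OF that]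
    by (intro euclidean_weight_two_valued) blast+
  have "euclidean_weight x E \<le> euclidean_weight x D" "spanning_tree {1..n} E"
    using assms(1) D by (auto simp: euclidean_mst_def)
  then show ?thesis using D \<open>a \<noteq> b\<close> by (simp add: w)
next
  case False
  \<comment> \<open>At most one of the two values occurs, so the feature is constant on the
    vertices.\<close>
  then have "x i = x j" if "(i, j) \<in> E" for i j
  proof -
    have "i \<in> {1..n}" "j \<in> {1..n}"
      using spanning_tree_edgeD[OF _ that] assms(1) unfolding euclidean_mst_def by blast+
    then show ?thesis using False x by blast
  qed
  then have "{(i, j) \<in> E. x i \<noteq> x j} = {}" by auto
  then show ?thesis by (metis card.empty zero_le)
qed

text \<open>A cycle of inside edges would be a cycle of the tree, so these edges form a forest on
  the class of \<open>a\<close>.\<close>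

lemma spanning_tree_inside_card_le:
  assumes "spanning_tree V E" "finite V"
  shows "card {(i, j) \<in> E. x i = a \<and> x j = a} \<le> card {i \<in> V. x i = a}"
proof (rule forest_card_le)
  have "cycle E c" if "cycle {(i, j) \<in> E. x i = a \<and> x j = a} c" for c
    using that unfolding cycle_def by blast
  then show "\<nexists>c. cycle {(i, j) \<in> E. x i = a \<and> x j = a} c"
    using assms by (auto simp: spanning_tree_def)
qed (use assms in \<open>auto simp: spanning_tree_def\<close>)

text \<open>Trades a sum over tree edges for a sum over sample points. In the application
  \<open>w\<close> is the probability that the edge is cut given the features, and \<open>g\<close>
  its value on an edge between coincident points.\<close>

lemma mst_two_valued_sum:
  fixes w :: "nat \<times> nat \<Rightarrow> real"
  assumes E: "euclidean_mst n x E" and x: "\<And>i. i \<in> {1..n} \<Longrightarrow> x i \<in> {a, b}" and ab: "a \<noteq> b"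
    and g: "g a \<in> {0..1}" "g b \<in> {0..1}"
    and w: "\<And>i j. (i, j) \<in> E \<Longrightarrow> x i = x j \<Longrightarrow> w (i, j) = g (x i)"
    and w01: "\<And>e. e \<in> E \<Longrightarrow> w e \<in> {0..1}"
  shows "\<bar>(\<Sum>e\<in>E. w e) - (\<Sum>i=1..n. g (x i))\<bar> \<le> 5"
proof -
  have st: "spanning_tree {1..n} E" using E by (simp add: euclidean_mst_def)
  then have fin: "finite E" by (rule spanning_tree_finite) simp
  define I where "I c = {(i, j) \<in> E. x i = c \<and> x j = c}" for c
  define N where "N c = {i \<in> {1..n}. x i = c}" for c
  define C where "C = {(i, j) \<in> E. x i \<noteq> x j}"
  have [simp]: "finite (I c)" "finite C" "finite (N c)" for c
    by (auto simp: I_def C_def N_def intro: finite_subset[OF _ fin])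
  have split: "E = I a \<union> I b \<union> C"
    using x spanning_tree_edgeD[OF st] by (fastforce simp: I_def C_def)
  have disj: "I a \<inter> I b = {}" "(I a \<union> I b) \<inter> C = {}" using ab by (auto simp: I_def C_def)
  have splitN: "{1..n} = N a \<union> N b" "N a \<inter> N b = {}" unfolding N_def using x ab by blast+
  have cE: "card E = card (I a) + card (I b) + card C"
    using disj by (subst split) (simp add: card_Un_disjoint)
  have cN: "n = card (N a) + card (N b)"
    using splitN by (metis card_Un_disjoint card_atLeastAtMost diff_Suc_1 \<open>\<And>c. finite (N c)\<close>)
  have "n \<le> Suc (card E)"
    using connected_card_le[of "{1..n}" E] st by (simp add: spanning_tree_def)
  moreover have le: "card (I c) \<le> card (N c)" for c
    using spanning_tree_inside_card_le[OF st] by (simp add: I_def N_def)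
  moreover have C1: "card C \<le> 1" using mst_two_valued_cross[OF E x ab] by (simp add: C_def)
  \<comment> \<open>The tree has at least \<open>n - 1\<close> edges, of which at most one crosses;
    hence the inside edges fall short of \<open>n\<close> by at most 2 in total, and each class by
    at most 2.\<close>
  ultimately have near: "card (N a) \<le> card (I a) + 2" "card (N b) \<le> card (I b) + 2"
    using cE cN le[of a] le[of b] by linarith+
  have "(\<Sum>e\<in>I c. w e) = (\<Sum>e\<in>I c. g c)" for c
    using w by (intro sum.cong) (auto simp: I_def)
  then have sE: "(\<Sum>e\<in>E. w e) = card (I a) * g a + card (I b) * g b + (\<Sum>e\<in>C. w e)"
    using disj by (subst split) (simp add: sum.union_disjoint)
  have "(\<Sum>i\<in>N c. g (x i)) = (\<Sum>i\<in>N c. g c)" for c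
    by (intro sum.cong) (auto simp: N_def)
  then have sN: "(\<Sum>i=1..n. g (x i)) = card (N a) * g a + card (N b) * g b"
    using splitN by (simp add: sum.union_disjoint)
  have "w e \<in> {0..1}" if "e \<in> C" for e using w01 that by (auto simp: C_def)
  then have "(\<Sum>e\<in>C. w e) \<le> (\<Sum>e\<in>C. 1)" "0 \<le> (\<Sum>e\<in>C. w e)"
    by (auto intro: sum_mono sum_nonneg simp del: sum_constant)
  then have sC: "(\<Sum>e\<in>C. w e) \<in> {0..1}" using C1 by simp
  \<comment> \<open>Each class loses between 0 and 2 and the cross edges add between 0 and 1, so the
    difference lies in [-4, 1], well within 5.\<close>
  have "(real (card (N c)) - card (I c)) * g c \<in> {0..2}"
    if "g c \<in> {0..1}" "card (N c) \<le> card (I c) + 2" for c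
    using that le[of c] mult_mono[of "real (card (N c)) - card (I c)" 2 "g c" 1] by auto
  from this[OF g(1) near(1)] this[OF g(2) near(2)] show ?thesis
    using sC unfolding sE sN by (auto simp: left_diff_distrib abs_le_iff)
qed

section \<open>Expectations over pairs of independent labels\<close>

text \<open>Split off coordinate \<open>i\<close>; coordinate \<open>j\<close> is then a marginal of
  the remaining product, which is independent of it.\<close>

lemma map_Pi_pmf_pair:
  assumes "finite A" "i \<in> A" "j \<in> A" "i \<noteq> j"
  shows "map_pmf (\<lambda>\<omega>. (\<omega> i, \<omega> j)) (Pi_pmf A d q) = pair_pmf (q i) (q j)"
proof -
  have "Pi_pmf A d q
      = map_pmf (\<lambda>(y, f). f(i := y)) (pair_pmf (q i) (Pi_pmf (A - {i}) d q))"
    using assms Pi_pmf_insert[of "A - {i}" i d q] by (simp add: insert_absorb)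
  then have "map_pmf (\<lambda>\<omega>. (\<omega> i, \<omega> j)) (Pi_pmf A d q)
      = map_pmf (apsnd (\<lambda>f. f j)) (pair_pmf (q i) (Pi_pmf (A - {i}) d q))"
    using assms(4) by (simp add: pmf.map_comp o_def case_prod_unfold apsnd_def map_prod_def)
  also have "\<dots> = pair_pmf (q i) (q j)"
    using assms by (simp add: pair_map_pmf2[symmetric] Pi_pmf_component)
  finally show ?thesis .
qed

lemma expectation_bind_finite:
  fixes h :: "'b \<Rightarrow> real"
  assumes "finite (set_pmf M)" "\<And>x. x \<in> set_pmf M \<Longrightarrow> finite (set_pmf (K x))"
  shows "measure_pmf.expectation (bind_pmf M K) h
      = measure_pmf.expectation M (\<lambda>x. measure_pmf.expectation (K x) h)"
  using assms
  by (simp add: pmf_expectation_bind[of "set_pmf M"] integral_measure_pmf_real[of "set_pmf M"] mult.commute)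

definition label_pmf :: "real \<Rightarrow> nat pmf" where
  "label_pmf \<alpha> = map_pmf (\<lambda>c. if c then 0 else 1) (bernoulli_pmf \<alpha>)"

lemma expectation_pair_label_pmf:
  fixes h :: "nat \<Rightarrow> nat \<Rightarrow> real"
  assumes "\<alpha> \<in> {0..1}" "\<beta> \<in> {0..1}"
  shows "measure_pmf.expectation (pair_pmf (label_pmf \<alpha>) (label_pmf \<beta>)) (\<lambda>(y, z). h y z)
    = h 0 0 * (\<alpha> * \<beta>) + h 0 1 * (\<alpha> * (1 - \<beta>)) + h 1 0 * ((1 - \<alpha>) * \<beta>)
      + h 1 1 * ((1 - \<alpha>) * (1 - \<beta>))"
proof -
  have U: "(UNIV :: (bool \<times> bool) set) = {(True, True), (True, False), (False, True), (False, False)}"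
    by (auto intro: bool.exhaust)
  have "measure_pmf.expectation Q k = (\<Sum>x\<in>UNIV. k x * pmf Q x)"
    for Q :: "(bool \<times> bool) pmf" and k :: "bool \<times> bool \<Rightarrow> real"
    by (rule integral_measure_pmf_real) auto
  then show ?thesis
    using assms unfolding label_pmf_def map_pair[symmetric] integral_map_pmf
    by (simp add: U pmf_pair)
qed

text \<open>A general \<open>h\<close> serves two purposes: the mismatch indicator for cut edges,
  and the product of class indicators for the null mean.\<close>

lemma expectation_Pi_pmf_label_pair:
  fixes h :: "nat \<Rightarrow> nat \<Rightarrow> real"
  assumes A: "finite A" "i \<in> A" "j \<in> A" "i \<noteq> j"
    and q: "map_pmf snd (q i) = label_pmf \<alpha>" "map_pmf snd (q j) = label_pmf \<beta>"
    and "\<alpha> \<in> {0..1}" "\<beta> \<in> {0..1}"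
  shows "measure_pmf.expectation (Pi_pmf A d q) (\<lambda>\<omega>. h (snd (\<omega> i)) (snd (\<omega> j)))
    = h 0 0 * (\<alpha> * \<beta>) + h 0 1 * (\<alpha> * (1 - \<beta>)) + h 1 0 * ((1 - \<alpha>) * \<beta>)
      + h 1 1 * ((1 - \<alpha>) * (1 - \<beta>))"
proof -
  have "measure_pmf.expectation (Pi_pmf A d q) (\<lambda>\<omega>. h (snd (\<omega> i)) (snd (\<omega> j)))
      = measure_pmf.expectation
          (map_pmf (\<lambda>(y, z). (snd y, snd z)) (map_pmf (\<lambda>\<omega>. (\<omega> i, \<omega> j)) (Pi_pmf A d q)))
          (\<lambda>(y, z). h y z)"
    by simp
  also have "map_pmf (\<lambda>(y, z). (snd y, snd z)) (map_pmf (\<lambda>\<omega>. (\<omega> i, \<omega> j)) (Pi_pmf A d q))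
      = pair_pmf (label_pmf \<alpha>) (label_pmf \<beta>)"
    unfolding map_Pi_pmf_pair[OF A] map_pair q ..
  finally show ?thesis using assms by (simp only: expectation_pair_label_pmf)
qed

text \<open>The conditional law of the labels given the features \<open>f\<close>, with a fixed
  tree. Linearity suffices: cuts of different edges may be dependent, but the two labels on one edge
  are independent.\<close>

lemma expectation_cut_edges:
  assumes E: "E \<subseteq> {(i, j). i \<in> A \<and> j \<in> A \<and> i < j}" and fin: "finite A"
    and e: "\<And>i. i \<in> A \<Longrightarrow> e i \<in> {0..1}"
  shows "measure_pmf.expectation
      (Pi_pmf A d (\<lambda>i. map_pmf (\<lambda>c. (f i, if c then 0 else 1)) (bernoulli_pmf (e i))))
      (\<lambda>\<omega>. real (cut_edges E (snd \<circ> \<omega>)))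
    = (\<Sum>(i, j)\<in>E. e i * (1 - e j) + e j * (1 - e i))"
    (is "measure_pmf.expectation (Pi_pmf A d ?q) _ = _")
proof -
  have finE: "finite E" by (rule finite_subset[of _ "A \<times> A"]) (use E fin in auto)
  have fs: "finite (set_pmf (Pi_pmf A d ?q))"
    using fin by (auto simp: set_Pi_pmf intro!: finite_PiE_dflt)
  have one: "measure_pmf.expectation (Pi_pmf A d ?q) (\<lambda>\<omega>. of_bool (snd (\<omega> i) \<noteq> snd (\<omega> j)))
      = e i * (1 - e j) + e j * (1 - e i)" if "(i, j) \<in> E" for i j
  proof -
    have ij: "i \<in> A" "j \<in> A" "i \<noteq> j" using that E by auto
    have "map_pmf snd (?q k) = label_pmf (e k)" for k
      by (simp add: label_pmf_def pmf.map_comp o_def)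
    note lab = this[of i] this[of j]
    show ?thesis
      using expectation_Pi_pmf_label_pair[where h = "\<lambda>y z. of_bool (y \<noteq> z)" and q = ?q and d = d,
          OF fin ij lab] e ij by simp
  qed
  have "real (cut_edges E z) = (\<Sum>(i, j)\<in>E. of_bool (z i \<noteq> z j))" for z :: "nat \<Rightarrow> nat"
    using finE by (simp add: cut_edges_def of_bool_def case_prod_unfold sum.If_cases Int_def)
  then have "measure_pmf.expectation (Pi_pmf A d ?q) (\<lambda>\<omega>. real (cut_edges E (snd \<circ> \<omega>)))
      = (\<Sum>(i, j)\<in>E. measure_pmf.expectation (Pi_pmf A d ?q)
          (\<lambda>\<omega>. of_bool (snd (\<omega> i) \<noteq> snd (\<omega> j))))"
    using fs by (simp add: case_prod_unfold Bochner_Integration.integral_sum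
        integrable_measure_pmf_finite)
  also have "\<dots> = (\<Sum>(i, j)\<in>E. e i * (1 - e j) + e j * (1 - e i))"
    by (intro sum.cong refl) (auto simp: one)
  finally show ?thesis .
qed

section \<open>The marginal label law and the mean of the null term\<close>

lemma finite_set_sample_pmf:
  assumes "finite (set_pmf \<mu>)"
  shows "finite (set_pmf (sample_pmf p \<mu> n))"
  using assms by (auto simp: sample_pmf_def labelled_pmf_def set_Pi_pmf intro!: finite_PiE_dflt)

text \<open>A mixture of Bernoulli laws is Bernoulli with the averaged parameter, so without
  knowledge of the feature a label is 0 with the prior probability \<open>u\<close>.\<close>

lemma map_snd_labelled_pmf:
  assumes "finite (set_pmf \<mu>)" "\<And>x. x \<in> set_pmf \<mu> \<Longrightarrow> p 0 x \<in> {0..1}"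
    and u: "measure_pmf.expectation \<mu> (p 0) = u"
  shows "map_pmf snd (labelled_pmf p \<mu>) = label_pmf u"
proof -
  \<comment> \<open>Needed because \<open>bernoulli_pmf u\<close> has masses \<open>u\<close> and
    \<open>1 - u\<close> only for such \<open>u\<close>.\<close>
  have "u \<in> {0..1}"
    using measure_pmf.integral_ge_const[of \<mu> "p 0" 0] measure_pmf.integral_le_const[of \<mu> "p 0" 1] assms
    by (auto simp: AE_measure_pmf_iff integrable_measure_pmf_finite)
  have "bind_pmf \<mu> (\<lambda>x. bernoulli_pmf (p 0 x)) = bernoulli_pmf u"
  proof (rule pmf_eqI)
    fix c
    have "pmf (bind_pmf \<mu> (\<lambda>x. bernoulli_pmf (p 0 x))) c
        = measure_pmf.expectation \<mu> (\<lambda>x. if c then p 0 x else 1 - p 0 x)"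
      unfolding pmf_bind using assms(2)
      by (intro integral_cong_AE) (cases c; auto simp: AE_measure_pmf_iff)+
    also have "\<dots> = pmf (bernoulli_pmf u) c"
      using u \<open>u \<in> {0..1}\<close> assms(1) by (cases c) (auto simp: integrable_measure_pmf_finite)
    finally show "pmf (bind_pmf \<mu> (\<lambda>x. bernoulli_pmf (p 0 x))) c = pmf (bernoulli_pmf u) c" .
  qed
  moreover have "map_pmf snd (labelled_pmf p \<mu>)
      = map_pmf (\<lambda>c. if c then 0 else 1) (bind_pmf \<mu> (\<lambda>x. bernoulli_pmf (p 0 x)))"
    by (simp add: labelled_pmf_def map_bind_pmf pmf.map_comp o_def)
  ultimately show ?thesis by (simp add: label_pmf_def)
qed

text \<open>The product of the class sizes counts ordered pairs with label 0 at \<open>i\<close> and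
  label 1 at \<open>j\<close>. The diagonal contributes nothing and each of the
  \<open>n * (n - 1)\<close> other pairs has probability \<open>u * (1 - u)\<close>; dividing by
  \<open>n\<close> leaves the factor \<open>n - 1\<close>.\<close>

lemma expectation_fr_null_mean:
  assumes "finite (set_pmf \<mu>)" "\<And>x. x \<in> set_pmf \<mu> \<Longrightarrow> p 0 x \<in> {0..1}"
    and u: "measure_pmf.expectation \<mu> (p 0) = u" "u \<in> {0..1}" and n: "n \<ge> 1"
  shows "measure_pmf.expectation (sample_pmf p \<mu> n) (\<lambda>\<omega>. fr_null_mean n (snd \<circ> \<omega>))
      = 2 * (real n - 1) * (u * (1 - u))"
proof -
  let ?M = "sample_pmf p \<mu> n"
  let ?h = "\<lambda>\<omega> i j. of_bool (snd (\<omega> i) = 0) * of_bool (snd (\<omega> j) = 1) :: real"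
  have int: "integrable ?M h" for h :: "(nat \<Rightarrow> 'a \<times> nat) \<Rightarrow> real"
    using assms(1) by (intro integrable_measure_pmf_finite finite_set_sample_pmf)
  have lab: "map_pmf snd (labelled_pmf p \<mu>) = label_pmf u"
    using assms(1,2) u(1) by (rule map_snd_labelled_pmf)
  have one: "measure_pmf.expectation ?M (\<lambda>\<omega>. ?h \<omega> i j) = (if i = j then 0 else u * (1 - u))"
    if "i \<in> {1..n}" "j \<in> {1..n}" for i j
  proof (cases "i = j")
    case False
    from expectation_Pi_pmf_label_pair[where q = "\<lambda>_. labelled_pmf p \<mu>" and d = undefined
        and h = "\<lambda>y z. of_bool (y = 0) * of_bool (z = 1)", OF _ that False lab lab u(2) u(2)]
    show ?thesis using False by (simp add: sample_pmf_def)
  next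
    case True
    then have "(\<lambda>\<omega>. ?h \<omega> i j) = (\<lambda>\<omega> :: nat \<Rightarrow> 'a \<times> nat. 0)"
      by (auto simp: fun_eq_iff of_bool_def)
    then show ?thesis using True by (simp only: integral_zero if_True simp_thms)
  qed
  have cs: "real (class_size n z c) = (\<Sum>i=1..n. of_bool (z i = c))" for z c
    by (simp add: class_size_def of_bool_def sum.If_cases Int_def)
  have "fr_null_mean n (snd \<circ> \<omega>) = 2 / n * (\<Sum>i=1..n. \<Sum>j=1..n. ?h \<omega> i j)"
    for \<omega> :: "nat \<Rightarrow> 'a \<times> nat"
    by (simp only: fr_null_mean_def cs comp_def sum_product[symmetric]) simp
  then have "measure_pmf.expectation ?M (\<lambda>\<omega>. fr_null_mean n (snd \<circ> \<omega>))
      = 2 / n * (\<Sum>i=1..n. \<Sum>j=1..n. measure_pmf.expectation ?M (\<lambda>\<omega>. ?h \<omega> i j))"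
    using int by (simp only: integral_mult_right_zero Bochner_Integration.integral_sum)
  also have "(\<Sum>i=1..n. \<Sum>j=1..n. measure_pmf.expectation ?M (\<lambda>\<omega>. ?h \<omega> i j))
      = (\<Sum>i=1..n. \<Sum>j=1..n. u * (1 - u) - (if i = j then u * (1 - u) else 0))"
    by (intro sum.cong refl) (subst one, auto)
  also have "\<dots> = real n * ((real n - 1) * (u * (1 - u)))"
    by (simp add: sum_subtractf) (simp add: algebra_simps)
  finally show ?thesis using n by (simp add: comp_def algebra_simps)
qed

section \<open>Expected cut edges by conditioning on the features\<close>

text \<open>Draws all features first and then all labels. The dummy feature is
  \<open>fst undefined\<close>, so that it agrees with the feature part of the dummy sample outside
  \<open>{1..n}\<close>.\<close>

lemma sample_pmf_bind_features:
  "sample_pmf p \<mu> n = bind_pmf (Pi_pmf {1..n} (fst (undefined :: 'a \<times> nat)) (\<lambda>_. \<mu>))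
     (\<lambda>f. Pi_pmf {1..n} undefined
        (\<lambda>i. map_pmf (\<lambda>c. (f i, if c then 0 else 1)) (bernoulli_pmf (p 0 (f i)))))"
  unfolding sample_pmf_def labelled_pmf_def by (rule Pi_pmf_bind) simp

text \<open>The complement is the probability that two independent labels agree, which is
  nonnegative.\<close>

lemma mismatch_prob_bounds:
  fixes \<alpha> \<beta> :: real
  assumes "\<alpha> \<in> {0..1}" "\<beta> \<in> {0..1}"
  shows "\<alpha> * (1 - \<beta>) + \<beta> * (1 - \<alpha>) \<in> {0..1}"
proof -
  have "0 \<le> \<alpha> * \<beta> + (1 - \<alpha>) * (1 - \<beta>)" "0 \<le> \<alpha> * (1 - \<beta>) + \<beta> * (1 - \<alpha>)"
    using assms by auto
  then show ?thesis by (simp add: algebra_simps)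
qed

text \<open>Given the features the tree is fixed, because \<open>T\<close> does not see the labels.
  The error 5 is that of \<open>mst_two_valued_sum\<close>; it holds for every feature vector in the
  support and does not grow with \<open>n\<close>.\<close>

lemma expectation_cut_edges_mst:
  fixes \<mu> :: "'a::real_normed_vector pmf" and T :: "nat \<Rightarrow> (nat \<Rightarrow> 'a) \<Rightarrow> (nat \<times> nat) set"
  assumes \<mu>: "set_pmf \<mu> \<subseteq> {a, b}" and ab: "a \<noteq> b"
    and p: "p 0 a \<in> {0..1}" "p 0 b \<in> {0..1}"
    and T: "\<And>n x. euclidean_mst n x (T n x)"
  shows "\<bar>measure_pmf.expectation (sample_pmf p \<mu> n) (\<lambda>\<omega>. real (cut_edges (T n (fst \<circ> \<omega>)) (snd \<circ> \<omega>)))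
      - real n * measure_pmf.expectation \<mu> (\<lambda>x. 2 * p 0 x * (1 - p 0 x))\<bar> \<le> 5"
proof -
  define M where "M = Pi_pmf {1..n} (fst (undefined :: 'a \<times> nat)) (\<lambda>_. \<mu>)"
  define K where "K f = Pi_pmf {1..n} undefined
      (\<lambda>i. map_pmf (\<lambda>c. (f i :: 'a, if c then 0 else 1 :: nat)) (bernoulli_pmf (p 0 (f i))))" for f
  define r where "r f = (\<Sum>(i, j)\<in>T n f. p 0 (f i) * (1 - p 0 (f j)) + p 0 (f j) * (1 - p 0 (f i)))" for f
  define g where "g x = 2 * p 0 x * (1 - p 0 x)" for x
  have fin: "finite (set_pmf \<mu>)" using \<mu> by (rule finite_subset) simp
  have finM: "finite (set_pmf M)" and finK: "finite (set_pmf (K f))" for f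
    using fin by (auto simp: M_def K_def set_Pi_pmf intro!: finite_PiE_dflt)
  have M: "f i \<in> {a, b}" if "f \<in> set_pmf M" "i \<in> {1..n}" for f i
    using that \<mu> by (auto simp: M_def set_Pi_pmf PiE_dflt_def)
  \<comment> \<open>Equality is required on all indices, since \<open>T n\<close> receives the whole
    function; outside \<open>{1..n}\<close> the matching dummy values provide it.\<close>
  have feat: "fst \<circ> \<omega> = f" if "f \<in> set_pmf M" "\<omega> \<in> set_pmf (K f)" for f \<omega>
  proof
    fix i
    show "(fst \<circ> \<omega>) i = f i"
    proof (cases "i \<in> {1..n}")
      case True
      then have "\<omega> i \<in> set_pmf (map_pmf (\<lambda>c. (f i, if c then 0 else 1)) (bernoulli_pmf (p 0 (f i))))"
        using that(2) by (simp add: K_def set_Pi_pmf PiE_dflt_def del: atLeastAtMost_iff set_map_pmf)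
      then show ?thesis by auto
    next
      case False
      then have "f i = fst (undefined :: 'a \<times> nat)" "\<omega> i = undefined"
        using that by (simp_all add: M_def K_def set_Pi_pmf PiE_dflt_def del: atLeastAtMost_iff)
      then show ?thesis by simp
    qed
  qed
  have inner: "measure_pmf.expectation (K f) (\<lambda>\<omega>. real (cut_edges (T n (fst \<circ> \<omega>)) (snd \<circ> \<omega>))) = r f"
    if f: "f \<in> set_pmf M" for f
  proof -
    have "measure_pmf.expectation (K f) (\<lambda>\<omega>. real (cut_edges (T n (fst \<circ> \<omega>)) (snd \<circ> \<omega>)))
        = measure_pmf.expectation (K f) (\<lambda>\<omega>. real (cut_edges (T n f) (snd \<circ> \<omega>)))"
      by (intro integral_cong_AE) (simp_all add: AE_measure_pmf_iff feat[OF f])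
    also have "\<dots> = r f"
      unfolding K_def r_def
    proof (rule expectation_cut_edges)
      show "T n f \<subseteq> {(i, j). i \<in> {1..n} \<and> j \<in> {1..n} \<and> i < j}"
        using T by (auto simp: euclidean_mst_def spanning_tree_def)
      show "p 0 (f i) \<in> {0..1}" if "i \<in> {1..n}" for i
        using M[OF f that] p by auto
    qed simp
    finally show ?thesis .
  qed
  have near: "\<bar>r f - (\<Sum>i=1..n. g (f i))\<bar> \<le> 5" if f: "f \<in> set_pmf M" for f
    unfolding r_def
  proof (rule mst_two_valued_sum[OF T])
    show "f i \<in> {a, b}" if "i \<in> {1..n}" for i using M[OF f that] .
    show "g a \<in> {0..1}" "g b \<in> {0..1}"
      using mismatch_prob_bounds[OF p(1) p(1)] mismatch_prob_bounds[OF p(2) p(2)] by (auto simp: g_def)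
    show "(case e of (i, j) \<Rightarrow> p 0 (f i) * (1 - p 0 (f j)) + p 0 (f j) * (1 - p 0 (f i))) \<in> {0..1}"
      if "e \<in> T n f" for e
    proof -
      obtain i j where e: "e = (i, j)" by fastforce
      have "i \<in> {1..n}" "j \<in> {1..n}"
        using T[of n f] that spanning_tree_edgeD unfolding euclidean_mst_def e by blast+
      then have "p 0 (f i) \<in> {0..1}" "p 0 (f j) \<in> {0..1}" using M[OF f] p by fastforce+
      from mismatch_prob_bounds[OF this] show ?thesis by (simp add: e)
    qed
  qed (use ab in \<open>auto simp: g_def\<close>)
  \<comment> \<open>Each feature has law \<open>\<mu>\<close>, so the sum over sample points has
    mean \<open>n\<close> times a single expectation.\<close>
  have "measure_pmf.expectation M (\<lambda>f. g (f i)) = measure_pmf.expectation \<mu> g" if "i \<in> {1..n}" for i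
    using that integral_map_pmf[of "\<lambda>f. f i" M g] by (simp add: M_def Pi_pmf_component)
  then have "measure_pmf.expectation M (\<lambda>f. \<Sum>i=1..n. g (f i)) = real n * measure_pmf.expectation \<mu> g"
    using finM by (simp add: Bochner_Integration.integral_sum integrable_measure_pmf_finite)
  moreover have "measure_pmf.expectation (sample_pmf p \<mu> n)
      (\<lambda>\<omega>. real (cut_edges (T n (fst \<circ> \<omega>)) (snd \<circ> \<omega>))) = measure_pmf.expectation M r"
  proof -
    have "sample_pmf p \<mu> n = bind_pmf M K"
      unfolding M_def K_def by (rule sample_pmf_bind_features)
    then show ?thesis
      using finM finK inner
      by (auto simp: expectation_bind_finite AE_measure_pmf_iff intro!: integral_cong_AE)
  qed
  moreover have "\<bar>measure_pmf.expectation M (\<lambda>f. r f - (\<Sum>i=1..n. g (f i)))\<bar> \<le> 5"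
  proof -
    have int: "integrable M h" for h :: "_ \<Rightarrow> real" using finM by (rule integrable_measure_pmf_finite)
    have "r f - (\<Sum>i=1..n. g (f i)) \<le> 5 \<and> -5 \<le> r f - (\<Sum>i=1..n. g (f i))"
      if "f \<in> set_pmf M" for f
      using near[OF that] by linarith
    then have "AE f in M. r f - (\<Sum>i=1..n. g (f i)) \<le> 5" "AE f in M. -5 \<le> r f - (\<Sum>i=1..n. g (f i))"
      by (simp_all add: AE_measure_pmf_iff)
    then show ?thesis
      using measure_pmf.integral_le_const[OF int] measure_pmf.integral_ge_const[OF int]
      by (simp add: abs_le_iff minus_le_iff)
  qed
  ultimately show ?thesis
    using finM unfolding g_def[symmetric]
    by (simp add: Bochner_Integration.integral_diff integrable_measure_pmf_finite)
qed

section \<open>The two-point marginal and the final estimate\<close>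

theorem theorem3:
  fixes s :: "nat \<Rightarrow> real ^ 'd" and H q0 q1 :: nat
    and p :: "nat \<Rightarrow> real ^ 'd \<Rightarrow> real" and u v :: real
    and P :: "(real ^ 'd) pmf"
    and T :: "nat \<Rightarrow> (nat \<Rightarrow> real ^ 'd) \<Rightarrow> (nat \<times> nat) set"
  assumes "inj_on s {1..H}"
    and "\<And>i. i \<in> {1..H} \<Longrightarrow> p 0 (s i) \<in> {0..1}"
    and "\<And>i. i \<in> {1..H} \<Longrightarrow> p 1 (s i) = 1 - p 0 (s i)"
    and "\<exists>i\<in>{1..H}. \<exists>j\<in>{1..H}. p 0 (s i) \<noteq> p 0 (s j)"
    and "0 < u" and "u < 1" and "v = 1 - u"
    and "Min ((\<lambda>i. p 0 (s i)) ` {1..H}) \<le> u"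
    and "u \<le> Max ((\<lambda>i. p 0 (s i)) ` {1..H})"
    and "is_arg_min (\<lambda>i. p 0 (s i)) (\<lambda>i. i \<in> {1..H}) q0"
    and "is_arg_max (\<lambda>i. p 0 (s i)) (\<lambda>i. i \<in> {1..H}) q1"
    and "P = pqstar (p 0) u (s q0) (s q1)"
    and "\<And>n x. euclidean_mst n x (T n x)"
  shows "(\<lambda>n. measure_pmf.expectation (sample_pmf p P n) (\<lambda>\<omega>. fr_variant T n \<omega> / real n)
            - ((\<Sum>x\<in>{s q0, s q1}. 2 * p 0 x * p 1 x * pmf P x) - 2 * u * v))
         \<in> O(\<lambda>n. 1 / real n)"
proof -
  let ?a = "s q0" and ?b = "s q1"
  let ?f = "\<lambda>i. p 0 (s i)"
  have q: "q0 \<in> {1..H}" "q1 \<in> {1..H}" and lo: "\<And>i. i \<in> {1..H} \<Longrightarrow> ?f q0 \<le> ?f i"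
    and hi: "\<And>i. i \<in> {1..H} \<Longrightarrow> ?f i \<le> ?f q1"
    using assms(10,11) by (auto simp: is_arg_min_linorder is_arg_max_linorder)
  have "Min (?f ` {1..H}) = ?f q0" using q lo by (intro Min_eqI) auto
  moreover have "Max (?f ` {1..H}) = ?f q1" using q hi by (intro Max_eqI) auto
  ultimately have u: "p 0 ?a \<le> u" "u \<le> p 0 ?b" using assms(8,9) by auto
  have lt: "p 0 ?a < p 0 ?b"
    using assms(4) lo hi by (metis antisym linorder_not_less order_trans)
  then have ab: "?a \<noteq> ?b" by auto
  have pmfP: "pmf P = pqstar_mass (p 0) u ?a ?b"
    unfolding assms(12) using u lt by (rule pmf_pqstar)
  \<comment> \<open>Only an inclusion: when \<open>u\<close> equals one of the extreme posteriors,
    one of the two masses is 0.\<close>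
  have supp: "set_pmf P \<subseteq> {?a, ?b}"
    by (auto simp: set_pmf_iff pmfP pqstar_mass_def split: if_splits)
  have fin: "finite (set_pmf P)" using supp by (rule finite_subset) simp
  have int: "measure_pmf.expectation P h = h ?a * pmf P ?a + h ?b * pmf P ?b" for h :: "_ \<Rightarrow> real"
    using integral_measure_pmf_real[of "{?a, ?b}" P h] supp ab by auto
  have p01: "p 0 ?a \<in> {0..1}" "p 0 ?b \<in> {0..1}" using assms(2) q by auto
  \<comment> \<open>The two masses are the weights that make the average posterior equal to the
    prior, so \<open>u\<close> is the label parameter in the null mean.\<close>
  have mean: "measure_pmf.expectation P (p 0) = u"
    unfolding int using lt ab by (simp add: pmfP pqstar_mass_def divide_simps) (simp add: algebra_simps)
  define G where "G = measure_pmf.expectation P (\<lambda>x. 2 * p 0 x * (1 - p 0 x))"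
  have G: "(\<Sum>x\<in>{?a, ?b}. 2 * p 0 x * p 1 x * pmf P x) = G"
    unfolding G_def int using ab assms(3) q by simp
  have uv: "u * v \<in> {0..1}" using assms(5-7) by (auto intro: mult_le_one)
  show ?thesis
  \<comment> \<open>The constant is 5 from the cut edges plus 2 as a bound for
    \<open>2 * u * v\<close>; from \<open>n = 1\<close> on, division by \<open>n\<close> is
    harmless.\<close>
  proof (rule bigoI[of _ 7], rule eventually_mono[OF eventually_ge_at_top[of 1]])
    fix n :: nat
    assume n: "1 \<le> n"
    define R where "R = measure_pmf.expectation (sample_pmf p P n)
      (\<lambda>\<omega>. real (cut_edges (T n (fst \<circ> \<omega>)) (snd \<circ> \<omega>)))"
    have R: "\<bar>R - real n * G\<bar> \<le> 5"
      unfolding R_def G_def by (rule expectation_cut_edges_mst[where p = p, OF supp ab p01 assms(13)])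
    have "measure_pmf.expectation (sample_pmf p P n) (\<lambda>\<omega>. fr_null_mean n (snd \<circ> \<omega>))
        = 2 * (real n - 1) * (u * (1 - u))"
      using fin supp p01 mean assms(5,6) n by (intro expectation_fr_null_mean) auto
    then have "measure_pmf.expectation (sample_pmf p P n) (fr_variant T n) = R - 2 * (real n - 1) * (u * v)"
      unfolding fr_variant_def R_def assms(7)
      using integrable_measure_pmf_finite[OF finite_set_sample_pmf[OF fin]]
      by (subst Bochner_Integration.integral_diff) simp_all
    \<comment> \<open>The term \<open>2 * (u * v)\<close> in the numerator remains because the null
      mean has the factor \<open>n - 1\<close> instead of \<open>n\<close>.\<close>
    then have "measure_pmf.expectation (sample_pmf p P n) (\<lambda>\<omega>. fr_variant T n \<omega> / real n)
        - ((\<Sum>x\<in>{?a, ?b}. 2 * p 0 x * p 1 x * pmf P x) - 2 * u * v)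
        = (R - real n * G + 2 * (u * v)) / real n"
      unfolding G using n by (simp add: field_simps)
    moreover have "\<bar>R - real n * G + 2 * (u * v)\<bar> \<le> 7" using R uv by auto
    ultimately show "norm (measure_pmf.expectation (sample_pmf p P n) (\<lambda>\<omega>. fr_variant T n \<omega> / real n)
        - ((\<Sum>x\<in>{?a, ?b}. 2 * p 0 x * p 1 x * pmf P x) - 2 * u * v)) \<le> 7 * norm (1 / real n)"
      using n by (simp add: divide_right_mono)
  qed
qed

end
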